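(* For every $\varepsilon > 0$ and every $t \in \mathbb{N}$ there exists a constant $C$ such that the following holds. Let $p = p(n) \in [0,1]$ satisfy $p > C/n^t$, and let $m := \binom{n}{\lfloor n/2 \rfloor}$. Then, with high probability, the largest antichain contained in the random family $\mathcal{P}(n,p)$ has size at most $(1+\varepsilon) p m t$.
   Context: $\mathbb{N} = \{1,2,\dots\}$. For $n \in \mathbb{N}$, $[n] = \{1,\dots,n\}$ and $\mathcal{P}(n)$ denotes the power set of $[n]$. A family $\mathcal{A} \subseteq \mathcal{P}(n)$ is an antichain if for any $A, B \in \mathcal{A}$ with $A \subseteq B$ we have $A = B$. For $p \in [0,1]$, $\mathcal{P}(n,p)$ is the random subset of $\mathcal{P}(n)$ obtained by selecting each element of $\mathcal{P}(n)$ with probability $p$, independently of all other choices. "With high probability" means with probability tending to $1$ as $n \to \infty$ (with $\varepsilon$ and $t$ fixed). *)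

theory Defs
  imports "HOL-Probability.Probability"
begin

definition antichain :: "'a set set \<Rightarrow> bool" where
  "antichain \<A> \<longleftrightarrow> (\<forall>A\<in>\<A>. \<forall>B\<in>\<A>. A \<subseteq> B \<longrightarrow> A = B)"

(* The set under Max contains 0 (empty antichain), and is finite whenever \<F> is finite. *)
definition largest_antichain_size :: "'a set set \<Rightarrow> nat" where
  "largest_antichain_size \<F> = Max (card ` {\<A>. \<A> \<subseteq> \<F> \<and> antichain \<A>})"

(* For p outside [0,1], bernoulli_pmf clamps p to [0,1]. *)
definition random_family :: "nat \<Rightarrow> real \<Rightarrow> nat set set pmf" where
  "random_family n p =
     map_pmf (\<lambda>f. {A \<in> Pow {1..n}. f A})
       (Pi_pmf (Pow {1..n}) False (\<lambda>_. bernoulli_pmf p))"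

end

theory Submission
  imports Defs "HOL-Combinatorics.Multiset_Permutations" "HOL-Real_Asymp.Real_Asymp"
begin

text \<open>
  Let \<open>\<alpha>(\<F>)\<close> be the size of a largest antichain in \<open>\<F>\<close>, let \<open>R\<close> be the random family, fix
  \<open>s > 0\<close>, and put \<open>M(\<F>) = E [exp (s \<alpha>(R \<inter> \<F>))]\<close>. Distinguishing whether a largest antichain
  uses a given \<open>v \<in> \<F>\<close> gives \<open>M(\<F>) \<le> M(\<F> - v) + p e\<^sup>s M(\<F> - v - {B. v \<subset> B})\<close>. If every
  family with more than \<open>N\<close> members has a member with at least \<open>d\<close> proper supersets in the family,
  the recursion shows that enlarging a family of size \<open>N\<close> by \<open>k\<close> sets costs at most a factor
  \<open>exp (x k)\<close>, for any \<open>x\<close> with \<open>p exp (s - x d) \<le> x\<close>.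
  This replaces the container lemma.

  Counting pairs on a random maximal chain shows that families with more than \<open>(r + \<delta>) m\<close> members
  have such a \<open>d\<close> of order \<open>n\<^sup>r\<close>. Choose \<open>x\<close> so that each descent costs a factor
  \<open>exp (\<beta> p m)\<close> with \<open>\<beta>\<close> small. From the full power set one reaches size \<open>(t + 2 + \<delta>) m\<close> with
  \<open>r = t + 2\<close>, because \<open>2 ^ n \<le> (n + 1) m\<close> makes \<open>x d\<close> at least of order \<open>n\<close>; from there one
  reaches size \<open>(t + \<delta>) m\<close> with \<open>r = t\<close> once \<open>p n\<^sup>t\<close> is large. For families of size at most
  \<open>(t + \<delta>) m\<close> use \<open>\<alpha>(R \<inter> \<F>) \<le> |R \<inter> \<F>|\<close>, and conclude with Chernoff's bound.
\<close>

section \<open>Random subsets\<close>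

definition random_subset :: "'a set \<Rightarrow> real \<Rightarrow> 'a set pmf" where
  "random_subset F p = map_pmf (\<lambda>f. {x \<in> F. f x}) (Pi_pmf F False (\<lambda>_. bernoulli_pmf p))"

lemma random_family_eq_random_subset: "random_family n p = random_subset (Pow {1..n}) p"
  by (simp add: random_family_def random_subset_def)

lemma set_pmf_random_subset_subset: "set_pmf (random_subset F p) \<subseteq> Pow F"
  by (auto simp: random_subset_def)

lemma finite_set_pmf_random_subset: "finite F \<Longrightarrow> finite (set_pmf (random_subset F p))"
  using set_pmf_random_subset_subset by (rule finite_subset) simp

lemma integrable_random_subset:
  fixes g :: "'a set \<Rightarrow> real"
  shows "finite F \<Longrightarrow> integrable (random_subset F p) g"
  by (intro integrable_measure_pmf_finite finite_set_pmf_random_subset)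

lemma expectation_random_subset_mono:
  fixes g h :: "'a set \<Rightarrow> real"
  assumes "finite F" "\<And>R. R \<subseteq> F \<Longrightarrow> g R \<le> h R"
  shows "measure_pmf.expectation (random_subset F p) g \<le>
    measure_pmf.expectation (random_subset F p) h"
  using assms set_pmf_random_subset_subset[of F p]
  by (intro integral_mono_AE integrable_random_subset) (auto intro!: AE_pmfI)

lemma random_subset_insert:
  assumes "finite F" "v \<notin> F"
  shows "random_subset (insert v F) p =
    bernoulli_pmf p \<bind> (\<lambda>b. map_pmf (\<lambda>R. if b then insert v R else R) (random_subset F p))"
  using assms
  by (auto simp: random_subset_def Pi_pmf_insert' map_bind_pmf map_pmf_def[symmetric]
      pmf.map_comp o_def intro!: bind_pmf_cong map_pmf_cong split: if_splits)

lemma expectation_random_subset_insert: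
  fixes g :: "'a set \<Rightarrow> real"
  assumes "finite F" "v \<notin> F" "0 \<le> p" "p \<le> 1"
  shows "measure_pmf.expectation (random_subset (insert v F) p) g =
    p * measure_pmf.expectation (random_subset F p) (\<lambda>R. g (insert v R))
    + (1 - p) * measure_pmf.expectation (random_subset F p) g"
  unfolding random_subset_insert[OF assms(1,2)] using assms
  by (subst pmf_expectation_bind[where A = UNIV])
    (auto simp: UNIV_bool finite_set_pmf_random_subset)

lemma map_pmf_Diff_random_subset:
  assumes "finite F"
  shows "map_pmf (\<lambda>R. R - N) (random_subset F p) = random_subset (F - N) p"
  using assms
  by (auto simp: random_subset_def Pi_pmf_subset[of F "F - N"] pmf.map_comp o_def
      intro!: map_pmf_cong)

lemma expectation_power_card_random_subset:
  assumes "finite F" "0 \<le> p" "p \<le> 1" "0 \<le> c"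
  shows "measure_pmf.expectation (random_subset F p) (\<lambda>R. c ^ card R) =
    (1 + p * (c - 1)) ^ card F"
proof -
  have "(\<Prod>x\<in>F. if f x then c else 1) = c ^ card {x \<in> F. f x}" for f
    using assms(1) by (simp add: prod.If_cases Int_def)
  then have "measure_pmf.expectation (random_subset F p) (\<lambda>R. c ^ card R) =
      measure_pmf.expectation (Pi_pmf F False (\<lambda>_. bernoulli_pmf p))
        (\<lambda>f. \<Prod>x\<in>F. if f x then c else 1)"
    by (simp add: random_subset_def)
  also have "\<dots> = (\<Prod>x\<in>F. measure_pmf.expectation (bernoulli_pmf p) (\<lambda>b. if b then c else 1))"
    using assms by (intro expectation_prod_Pi_pmf integrable_measure_pmf_finite) auto
  also have "\<dots> = (1 + p * (c - 1)) ^ card F"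
    using assms by (simp add: algebra_simps)
  finally show ?thesis .
qed

section \<open>Exponential moments of the largest antichain\<close>

lemma antichain_subset: "antichain \<A> \<Longrightarrow> \<B> \<subseteq> \<A> \<Longrightarrow> antichain \<B>"
  unfolding antichain_def by (meson subsetD)

lemma card_le_largest_antichain_size:
  assumes "finite \<F>" "\<A> \<subseteq> \<F>" "antichain \<A>"
  shows "card \<A> \<le> largest_antichain_size \<F>"
  unfolding largest_antichain_size_def using assms by (intro Max_ge) auto

lemma largest_antichain_size_attained:
  assumes "finite \<F>"
  obtains \<A> where "\<A> \<subseteq> \<F>" "antichain \<A>" "card \<A> = largest_antichain_size \<F>"
proof -
  have "{} \<in> {\<A>. \<A> \<subseteq> \<F> \<and> antichain \<A>}" by (simp add: antichain_def)
  then have "largest_antichain_size \<F> \<in> card ` {\<A>. \<A> \<subseteq> \<F> \<and> antichain \<A>}"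
    unfolding largest_antichain_size_def using assms by (intro Max_in) auto
  then show ?thesis using that by auto
qed

lemma largest_antichain_size_le_card:
  assumes "finite \<F>" shows "largest_antichain_size \<F> \<le> card \<F>"
  by (rule largest_antichain_size_attained[OF assms]) (metis assms card_mono)

lemma largest_antichain_size_insert_le:
  assumes "finite \<F>"
  shows "largest_antichain_size (insert v \<F>) \<le> largest_antichain_size \<F> \<or>
    largest_antichain_size (insert v \<F>) \<le> Suc (largest_antichain_size (\<F> - {B. v \<subset> B}))"
proof -
  obtain \<A> where \<A>: "\<A> \<subseteq> insert v \<F>" "antichain \<A>"
    "card \<A> = largest_antichain_size (insert v \<F>)"
    using largest_antichain_size_attained[of "insert v \<F>"] assms by auto
  show ?thesis
  proof (cases "v \<in> \<A>")
    case False
    then have "card \<A> \<le> largest_antichain_size \<F>"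
      using \<A> assms by (intro card_le_largest_antichain_size) auto
    then show ?thesis using \<A>(3) by simp
  next
    case True
    have "card (\<A> - {v}) \<le> largest_antichain_size (\<F> - {B. v \<subset> B})"
    proof (rule card_le_largest_antichain_size)
      show "\<A> - {v} \<subseteq> \<F> - {B. v \<subset> B}"
        using \<A> True unfolding antichain_def by blast
      show "antichain (\<A> - {v})" using \<A>(2) by (rule antichain_subset) auto
    qed (use assms in auto)
    moreover have "card \<A> = Suc (card (\<A> - {v}))"
      using True \<A>(1) assms by (metis card.remove finite_insert finite_subset)
    ultimately show ?thesis using \<A>(3) by simp
  qed
qed

lemma exp_largest_antichain_size_insert_le:
  assumes "finite \<F>" "0 \<le> s"
  shows "exp (s * real (largest_antichain_size (insert v \<F>))) \<le>
    exp (s * real (largest_antichain_size \<F>)) +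
    exp s * exp (s * real (largest_antichain_size (\<F> - {B. v \<subset> B})))"
  using largest_antichain_size_insert_le[OF assms(1), of v]
proof
  assume "largest_antichain_size (insert v \<F>) \<le> largest_antichain_size \<F>"
  then show ?thesis using assms(2) by (simp add: mult_left_mono add_increasing2)
next
  assume "largest_antichain_size (insert v \<F>) \<le>
    Suc (largest_antichain_size (\<F> - {B. v \<subset> B}))"
  then have "s * real (largest_antichain_size (insert v \<F>)) \<le>
      s * real (Suc (largest_antichain_size (\<F> - {B. v \<subset> B})))"
    using assms(2) by (intro mult_left_mono of_nat_mono)
  then show ?thesis by (simp add: exp_add[symmetric] distrib_left add_increasing)
qed

definition antichain_moment :: "real \<Rightarrow> real \<Rightarrow> 'a set set \<Rightarrow> real" where
  "antichain_moment p s \<F> =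
    measure_pmf.expectation (random_subset \<F> p) (\<lambda>\<R>. exp (s * real (largest_antichain_size \<R>)))"

lemma antichain_moment_nonneg: "0 \<le> antichain_moment p s \<F>"
  unfolding antichain_moment_def by (intro integral_nonneg_AE) simp

lemma antichain_moment_le_exp:
  assumes "finite \<F>" "0 \<le> p" "p \<le> 1" "0 \<le> s"
  shows "antichain_moment p s \<F> \<le> exp (p * (exp s - 1) * real (card \<F>))"
proof -
  have "antichain_moment p s \<F> \<le>
      measure_pmf.expectation (random_subset \<F> p) (\<lambda>\<R>. exp s ^ card \<R>)"
    unfolding antichain_moment_def
  proof (rule expectation_random_subset_mono)
    fix \<R> assume "\<R> \<subseteq> \<F>"
    then have "largest_antichain_size \<R> \<le> card \<R>"
      using assms(1) by (intro largest_antichain_size_le_card) (rule finite_subset)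
    then show "exp (s * real (largest_antichain_size \<R>)) \<le> exp s ^ card \<R>"
      using assms(4) by (simp add: exp_of_nat2_mult[symmetric] mult_left_mono)
  qed fact
  also have "\<dots> = (1 + p * (exp s - 1)) ^ card \<F>"
    using assms by (simp add: expectation_power_card_random_subset)
  also have "\<dots> \<le> exp (p * (exp s - 1)) ^ card \<F>"
    using assms by (intro power_mono exp_ge_add_one_self) auto
  also have "\<dots> = exp (p * (exp s - 1) * real (card \<F>))"
    by (simp add: exp_of_nat2_mult)
  finally show ?thesis .
qed

lemma antichain_moment_insert_le:
  assumes "finite \<F>" "0 \<le> p" "p \<le> 1" "0 \<le> s" "v \<notin> \<F>"
  shows "antichain_moment p s (insert v \<F>) \<le>
    antichain_moment p s \<F> + p * exp s * antichain_moment p s (\<F> - {B. v \<subset> B})"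
proof -
  let ?E = "measure_pmf.expectation (random_subset \<F> p)"
  let ?g = "\<lambda>\<R>. exp (s * real (largest_antichain_size \<R>))" and ?up = "{B. v \<subset> B}"
  have "?E (\<lambda>\<R>. ?g (insert v \<R>)) \<le> ?E (\<lambda>\<R>. ?g \<R> + exp s * ?g (\<R> - ?up))"
  proof (rule expectation_random_subset_mono)
    fix \<R> assume "\<R> \<subseteq> \<F>"
    then show "?g (insert v \<R>) \<le> ?g \<R> + exp s * ?g (\<R> - ?up)"
      using assms(1,4) by (intro exp_largest_antichain_size_insert_le) (rule finite_subset)
  qed fact
  also have "\<dots> = ?E ?g + exp s * ?E (\<lambda>\<R>. ?g (\<R> - ?up))"
    using assms(1) by (simp add: integrable_random_subset)
  also have "?E (\<lambda>\<R>. ?g (\<R> - ?up)) = antichain_moment p s (\<F> - ?up)"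
    using assms(1) by (simp add: antichain_moment_def map_pmf_Diff_random_subset[symmetric])
  finally have "p * ?E (\<lambda>\<R>. ?g (insert v \<R>)) \<le>
      p * (?E ?g + exp s * antichain_moment p s (\<F> - ?up))"
    using assms(2) by (rule mult_left_mono)
  then show ?thesis
    using assms by (simp add: antichain_moment_def expectation_random_subset_insert algebra_simps)
qed

lemma prob_largest_antichain_size_le:
  assumes "finite \<F>" "0 < s"
  shows "1 - exp (- s * K) * antichain_moment p s \<F> \<le>
    measure_pmf.prob (random_subset \<F> p) {\<R>. real (largest_antichain_size \<R>) \<le> K}"
proof -
  let ?P = "measure_pmf.prob (random_subset \<F> p)"
    and ?small = "{\<R>. real (largest_antichain_size \<R>) \<le> K}"
  have "1 - ?P ?small = ?P (UNIV - ?small)"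
    using measure_pmf.prob_compl[of ?small "random_subset \<F> p"] by simp
  also have "\<dots> \<le> ?P {\<R>. K \<le> real (largest_antichain_size \<R>)}"
    by (intro measure_pmf.finite_measure_mono) auto
  also have "\<dots> \<le> exp (- s * K) * antichain_moment p s \<F>"
    using measure_pmf.Chernoff_ineq_ge[OF assms(2), where A = UNIV and a = K
        and f = "\<lambda>\<R>. real (largest_antichain_size \<R>)" and M = "random_subset \<F> p"]
    by (simp add: antichain_moment_def set_integrable_def set_lebesgue_integral_def
        integrable_random_subset[OF assms(1)])
  finally show ?thesis by simp
qed

section \<open>Descent along supersaturated families\<close>

definition up_degree :: "'a set set \<Rightarrow> 'a set \<Rightarrow> nat" where
  "up_degree \<F> A = card {B \<in> \<F>. A \<subset> B}"

lemma up_degree_mono: "finite \<F> \<Longrightarrow> \<G> \<subseteq> \<F> \<Longrightarrow> up_degree \<G> A \<le> up_degree \<F> A"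
  unfolding up_degree_def by (intro card_mono) auto

lemma card_Diff_singleton_up_degree:
  assumes "finite \<F>" "v \<in> \<F>"
  shows "card \<F> = Suc (card (\<F> - {v} - {B. v \<subset> B}) + up_degree \<F> v)"
proof -
  have "\<F> - {v} = (\<F> - {v} - {B. v \<subset> B}) \<union> {B \<in> \<F>. v \<subset> B}" by auto
  moreover have "card \<dots> = card (\<F> - {v} - {B. v \<subset> B}) + up_degree \<F> v"
    unfolding up_degree_def using assms(1) by (intro card_Un_disjoint) auto
  ultimately show ?thesis using assms by (metis card.remove)
qed

definition supersaturated :: "real \<Rightarrow> real \<Rightarrow> 'a set set \<Rightarrow> bool" where
  "supersaturated N d \<F> \<longleftrightarrow>
    (\<forall>\<G>\<subseteq>\<F>. N < real (card \<G>) \<longrightarrow> (\<exists>A\<in>\<G>. d \<le> real (up_degree \<G> A)))"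

definition antichain_moment_bounded :: "real \<Rightarrow> real \<Rightarrow> 'a set set \<Rightarrow> real \<Rightarrow> real \<Rightarrow> bool" where
  "antichain_moment_bounded p s \<F> N b \<longleftrightarrow>
    (\<forall>\<G>\<subseteq>\<F>. real (card \<G>) \<le> N \<longrightarrow> antichain_moment p s \<G> \<le> b)"

lemma antichain_moment_step:
  assumes "finite \<F>" "0 \<le> p" "p \<le> 1" "0 \<le> s" "0 \<le> b" "0 \<le> x"
    and v: "v \<in> \<F>" "d \<le> real (up_degree \<F> v)"
    and admissible: "p * exp (s - x * d) \<le> x"
    and smaller: "\<And>\<G>. \<G> \<subset> \<F> \<Longrightarrow> antichain_moment p s \<G> \<le> b * exp (x * real (card \<G>))"
  shows "antichain_moment p s \<F> \<le> b * exp (x * real (card \<F>))"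
proof -
  define \<G> \<H> where "\<G> = \<F> - {v}" and "\<H> = \<G> - {B. v \<subset> B}"
  let ?k = "real (card \<F>)" and ?M = "antichain_moment p s"
  have \<F>: "\<F> = insert v \<G>" "v \<notin> \<G>" and fin: "finite \<G>"
    using assms(1) v(1) by (auto simp: \<G>_def)
  have "?M \<G> \<le> b * exp (x * real (card \<G>))"
    using smaller[of \<G>] \<F> by auto
  also have "real (card \<G>) = ?k - 1" using fin \<F> by simp
  finally have moment_\<G>: "?M \<G> \<le> b * exp (x * (?k - 1))" .
  have "?M \<H> \<le> b * exp (x * real (card \<H>))"
    using v(1) by (intro smaller) (auto simp: \<G>_def \<H>_def)
  also have "real (card \<H>) \<le> ?k - 1 - d"
    using card_Diff_singleton_up_degree[OF assms(1) v(1)] v(2) by (simp add: \<G>_def \<H>_def)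
  then have "b * exp (x * real (card \<H>)) \<le> b * exp (x * (?k - 1 - d))"
    using assms(5,6) by (simp add: mult_left_mono)
  finally have moment_\<H>: "?M \<H> \<le> b * exp (x * (?k - 1 - d))" .
  have "?M \<F> \<le> ?M \<G> + p * exp s * ?M \<H>"
    unfolding \<F>(1) \<H>_def using fin assms(2-4) \<F>(2) by (rule antichain_moment_insert_le)
  also have "\<dots> \<le> b * exp (x * (?k - 1)) + p * exp s * (b * exp (x * (?k - 1 - d)))"
    using assms(2) moment_\<G> moment_\<H> by (intro add_mono mult_left_mono) auto
  also have "\<dots> = b * exp (x * (?k - 1)) * (1 + p * exp (s - x * d))"
    using exp_add[of "x * (?k - 1)" "- (x * d)"] exp_add[of s "- (x * d)"]
    by (simp add: algebra_simps)
  also have "\<dots> \<le> b * exp (x * (?k - 1)) * exp x"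
  proof (rule mult_left_mono)
    show "1 + p * exp (s - x * d) \<le> exp x"
      using admissible exp_ge_add_one_self[of x] by linarith
  qed (use assms(5) in simp)
  also have "\<dots> = b * exp (x * ?k)"
    by (simp add: algebra_simps exp_add[symmetric])
  finally show ?thesis .
qed

lemma antichain_moment_le_of_supersaturated:
  assumes "finite \<F>" "0 \<le> p" "p \<le> 1" "0 \<le> s" "0 \<le> b" "0 \<le> x"
    and bounded: "antichain_moment_bounded p s \<F> N b"
    and supersat: "supersaturated N d \<F>"
    and admissible: "p * exp (s - x * d) \<le> x"
    and "\<G> \<subseteq> \<F>"
  shows "antichain_moment p s \<G> \<le> b * exp (x * real (card \<G>))"
  using finite_subset[OF assms(10,1)] assms(10)
proof (induction \<G> rule: finite_psubset_induct)
  case (psubset \<G>)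
  show ?case
  proof (cases "real (card \<G>) \<le> N")
    case True
    then have "antichain_moment p s \<G> \<le> b * 1"
      using bounded psubset.prems by (simp add: antichain_moment_bounded_def)
    also have "\<dots> \<le> b * exp (x * real (card \<G>))"
      using assms(5,6) by (intro mult_left_mono) auto
    finally show ?thesis .
  next
    case False
    then obtain v where "v \<in> \<G>" "d \<le> real (up_degree \<G> v)"
      using supersat psubset.prems unfolding supersaturated_def by (meson not_le)
    with psubset.hyps assms(2-6) show ?thesis
    proof (rule antichain_moment_step)
      fix \<H> assume "\<H> \<subset> \<G>"
      then show "antichain_moment p s \<H> \<le> b * exp (x * real (card \<H>))"
        using psubset.IH psubset.prems by blast
    qed fact
  qed
qed

lemma antichain_moment_bounded_descent:
  assumes "finite \<F>" "0 \<le> p" "p \<le> 1" "0 \<le> s"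
    and bounded: "antichain_moment_bounded p s \<F> N b"
    and supersat: "supersaturated N d \<F>"
    and admissible: "exp (s - y * (p * d)) \<le> y"
  shows "antichain_moment_bounded p s \<F> N' (b * exp (p * y * N'))"
  unfolding antichain_moment_bounded_def
proof (intro allI impI)
  fix \<G> assume \<G>: "\<G> \<subseteq> \<F>" "real (card \<G>) \<le> N'"
  have "0 \<le> y" using admissible exp_ge_zero order_trans by blast
  then have py: "0 \<le> p * y" using assms(2) by simp
  have "real (card ({} :: 'a set set)) \<le> N"
    using supersat unfolding supersaturated_def by (meson empty_iff empty_subsetI not_less)
  then have "0 \<le> b"
    using bounded antichain_moment_nonneg[of p s "{} :: 'a set set"]
    unfolding antichain_moment_bounded_def by (meson empty_subsetI order_trans)
  have "p * exp (s - p * y * d) \<le> p * y"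
    using mult_left_mono[OF admissible assms(2)] by (simp add: mult_ac)
  with assms(1-4) \<open>0 \<le> b\<close> py bounded supersat
  have "antichain_moment p s \<G> \<le> b * exp (p * y * real (card \<G>))"
    using \<G>(1) by (rule antichain_moment_le_of_supersaturated)
  also have "\<dots> \<le> b * exp (p * y * N')"
    using \<open>0 \<le> b\<close> mult_left_mono[OF \<G>(2) py] by (intro mult_left_mono) auto
  finally show "antichain_moment p s \<G> \<le> b * exp (p * y * N')" .
qed

lemma antichain_moment_bounded_exp:
  assumes "finite \<F>" "0 \<le> p" "p \<le> 1" "0 \<le> s"
  shows "antichain_moment_bounded p s \<F> N (exp (p * (exp s - 1) * N))"
  unfolding antichain_moment_bounded_def
proof (intro allI impI)
  fix \<G> assume "\<G> \<subseteq> \<F>" and card: "real (card \<G>) \<le> N"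
  then have "antichain_moment p s \<G> \<le> exp (p * (exp s - 1) * real (card \<G>))"
    using assms by (intro antichain_moment_le_exp) (auto intro: finite_subset)
  also have "\<dots> \<le> exp (p * (exp s - 1) * N)"
    using assms card by (simp add: mult_left_mono)
  finally show "antichain_moment p s \<G> \<le> exp (p * (exp s - 1) * N)" .
qed

section \<open>Random maximal chains\<close>

definition prefix_chain :: "'a list \<Rightarrow> 'a set set" where
  "prefix_chain xs = {A. set (take (card A) xs) = A}"

lemma prefix_chain_subset:
  assumes "A \<in> prefix_chain xs" "B \<in> prefix_chain xs" "card A \<le> card B"
  shows "A \<subseteq> B"
  using assms set_take_subset_set_take[of "card A" "card B" xs] by (simp add: prefix_chain_def)

lemma inj_on_card_prefix_chain: "inj_on card (prefix_chain xs)"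
  by (rule inj_onI) (simp add: prefix_chain_subset subset_antisym)

lemma append_in_prefix_chain_iff:
  assumes "distinct (us @ ws)" "set us \<subseteq> B" "finite B"
  shows "B \<in> prefix_chain (us @ ws) \<longleftrightarrow> B - set us \<in> prefix_chain ws"
proof -
  have "card B = length us + card (B - set us)"
    using assms by (metis card_Diff_subset card_mono distinct_append distinct_card
        finite_set le_add_diff_inverse)
  then have "set (take (card B) (us @ ws)) = set us \<union> set (take (card (B - set us)) ws)"
    by simp
  moreover have "set us \<inter> set (take (card (B - set us)) ws) = {}"
    using assms(1) set_take_subset[of "card (B - set us)" ws] by auto
  ultimately show ?thesis
    unfolding prefix_chain_def mem_Collect_eq using assms(2) by blast
qed

lemma permutations_through_set_eq:
  assumes "finite U" "A \<subseteq> U"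
  shows "{xs \<in> permutations_of_set U. A \<in> prefix_chain xs} =
    (\<lambda>(us, ws). us @ ws) ` (permutations_of_set A \<times> permutations_of_set (U - A))"
    (is "?L = ?R")
proof
  show "?R \<subseteq> ?L"
  proof clarify
    fix us ws
    assume us: "us \<in> permutations_of_set A" and ws: "ws \<in> permutations_of_set (U - A)"
    then have "set us = A" "set ws = U - A" "distinct (us @ ws)"
      by (auto simp: permutations_of_set_def)
    moreover have "length us = card A"
      using us assms finite_subset length_finite_permutations_of_set by blast
    ultimately show "us @ ws \<in> permutations_of_set U \<and> A \<in> prefix_chain (us @ ws)"
      using assms(2) by (auto simp: prefix_chain_def permutations_of_set_def)
  qed
  show "?L \<subseteq> ?R"
  proof
    fix xs assume "xs \<in> ?L"
    then have xs: "distinct xs" "set xs = U" and A: "set (take (card A) xs) = A"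
      by (auto simp: prefix_chain_def dest: permutations_of_setD)
    have "set (drop (card A) xs) = U - A"
      using set_take_disj_set_drop_if_distinct[OF xs(1) order_refl, of "card A"]
        set_append[of "take (card A) xs" "drop (card A) xs"] A xs(2) by auto
    with A xs(1) have "(take (card A) xs, drop (card A) xs) \<in>
        permutations_of_set A \<times> permutations_of_set (U - A)"
      by (auto intro!: permutations_of_setI)
    then show "xs \<in> ?R" by (rule rev_image_eqI) simp
  qed
qed

lemma inj_on_append_permutations:
  assumes "finite A" shows "inj_on (\<lambda>(us, ws). us @ ws) (permutations_of_set A \<times> W)"
  using assms by (auto simp: inj_on_def length_finite_permutations_of_set)

lemma card_permutations_through_set:
  assumes "finite U" "A \<subseteq> U"
  shows "real (card {xs \<in> permutations_of_set U. A \<in> prefix_chain xs}) =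
    fact (card U) / real (card U choose card A)"
proof -
  have fin: "finite A" using assms finite_subset by blast
  have "card {xs \<in> permutations_of_set U. A \<in> prefix_chain xs} =
      fact (card A) * fact (card U - card A)"
    using assms fin by (simp add: permutations_through_set_eq card_image inj_on_append_permutations
        card_cartesian_product card_Diff_subset)
  moreover have "card A \<le> card U" using assms by (rule card_mono)
  ultimately show ?thesis by (simp add: binomial_fact)
qed

lemma card_permutations_through_two_sets:
  assumes "finite U" "A \<subseteq> B" "B \<subseteq> U"
  shows "real (card {xs \<in> permutations_of_set U. A \<in> prefix_chain xs \<and> B \<in> prefix_chain xs}) =
    fact (card U) /
      (real (card U choose card A) * real ((card U - card A) choose (card B - card A)))"
proof -
  let ?W = "{ws \<in> permutations_of_set (U - A). B - A \<in> prefix_chain ws}"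
  have fin: "finite A" "finite B" and AU: "A \<subseteq> U" using assms by (auto intro: finite_subset)
  have B_iff: "B \<in> prefix_chain (us @ ws) \<longleftrightarrow> B - A \<in> prefix_chain ws"
    if "us \<in> permutations_of_set A" "ws \<in> permutations_of_set (U - A)" for us ws
  proof -
    have "set us = A" "distinct (us @ ws)" using that by (auto dest: permutations_of_setD)
    then show ?thesis using append_in_prefix_chain_iff[of us ws B] assms(2) fin by simp
  qed
  have "{xs \<in> permutations_of_set U. A \<in> prefix_chain xs \<and> B \<in> prefix_chain xs} =
      {xs \<in> {xs \<in> permutations_of_set U. A \<in> prefix_chain xs}. B \<in> prefix_chain xs}"
    by auto
  also have "\<dots> = (\<lambda>(us, ws). us @ ws) ` (permutations_of_set A \<times> ?W)"
    unfolding permutations_through_set_eq[OF assms(1) AU] using B_iff by auto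
  finally have "card {xs \<in> permutations_of_set U. A \<in> prefix_chain xs \<and> B \<in> prefix_chain xs} =
      fact (card A) * card ?W"
    using fin by (simp add: card_image inj_on_append_permutations card_cartesian_product)
  also have "real \<dots> = fact (card A) *
      (fact (card U - card A) / real ((card U - card A) choose (card B - card A)))"
    using card_permutations_through_set[of "U - A" "B - A"] assms AU fin
    by (simp add: card_Diff_subset Diff_mono)
  also have "\<dots> = fact (card U) /
      (real (card U choose card A) * real ((card U - card A) choose (card B - card A)))"
    using card_mono[OF assms(1) AU] by (simp add: binomial_fact)
  finally show ?thesis .
qed

text \<open>Pairing the element of least \<open>f\<close>-value with all elements at least \<open>t\<close> above it misses
  at most \<open>t\<close> elements.\<close>

lemma card_le_card_separated_pairs:
  fixes f :: "'a \<Rightarrow> nat"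
  assumes "finite C" "inj_on f C"
  shows "card C \<le> t + card {(x, y) \<in> C \<times> C. f x + t \<le> f y}"
proof (cases "C = {}")
  case False
  then obtain x where x: "x \<in> C" "\<And>y. y \<in> C \<Longrightarrow> f x \<le> f y"
    using ex_has_least_nat[of "\<lambda>x. x \<in> C" _ f] by blast
  let ?near = "{y \<in> C. f y < f x + t}" and ?far = "{y \<in> C. f x + t \<le> f y}"
  have "card ?near \<le> card {f x..<f x + t}"
    using x inj_on_subset[OF assms(2), of ?near] by (intro card_inj_on_le[of f]) auto
  moreover have "card ?far \<le> card {(x, y) \<in> C \<times> C. f x + t \<le> f y}"
    using x assms(1) by (intro card_inj_on_le[of "Pair x"])
      (auto simp: inj_on_def intro: finite_subset[of _ "C \<times> C"])
  moreover have "C = ?near \<union> ?far" by auto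
  then have "card C \<le> card ?near + card ?far" by (metis card_Un_le)
  ultimately show ?thesis by simp
qed simp

definition far_pairs :: "nat \<Rightarrow> 'a set set \<Rightarrow> ('a set \<times> 'a set) set" where
  "far_pairs t \<F> = {(A, B) \<in> \<F> \<times> \<F>. A \<subseteq> B \<and> card A + t \<le> card B}"

lemma finite_far_pairs: "finite \<F> \<Longrightarrow> finite (far_pairs t \<F>)"
  unfolding far_pairs_def by (rule finite_subset[of _ "\<F> \<times> \<F>"]) auto

lemma card_prefix_chain_le_card_far_pairs:
  assumes "finite \<F>"
  shows "card {A \<in> \<F>. A \<in> prefix_chain xs} \<le>
    t + card {AB \<in> far_pairs t \<F>. fst AB \<in> prefix_chain xs \<and> snd AB \<in> prefix_chain xs}"
    (is "card ?C \<le> t + card ?T")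
proof -
  have "inj_on card ?C" using inj_on_card_prefix_chain by (rule inj_on_subset) auto
  with assms have "card ?C \<le> t + card {(A, B) \<in> ?C \<times> ?C. card A + t \<le> card B}"
    by (intro card_le_card_separated_pairs) auto
  also have "{(A, B) \<in> ?C \<times> ?C. card A + t \<le> card B} \<subseteq> ?T"
    using prefix_chain_subset by (fastforce simp: far_pairs_def)
  then have "card {(A, B) \<in> ?C \<times> ?C. card A + t \<le> card B} \<le> card ?T"
    using finite_far_pairs[OF assms] by (intro card_mono) auto
  finally show ?thesis by simp
qed

text \<open>For \<open>t = 1\<close> and an antichain \<open>\<F>\<close> this is the LYM inequality.\<close>

lemma sum_inverse_binomial_le_far_pairs:
  assumes "finite U" "\<F> \<subseteq> Pow U"
  defines "n \<equiv> card U"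
  shows "(\<Sum>A\<in>\<F>. 1 / real (n choose card A)) \<le>
    real t + (\<Sum>(A, B)\<in>far_pairs t \<F>.
      1 / (real (n choose card A) * real ((n - card A) choose (card B - card A))))"
    (is "?singles \<le> real t + ?pairs")
proof -
  let ?S = "permutations_of_set U"
  let ?on = "\<lambda>xs AB. fst AB \<in> prefix_chain xs \<and> snd AB \<in> prefix_chain xs"
  have fin: "finite \<F>" using assms finite_subset by blast
  have "fact n * ?singles = (\<Sum>A\<in>\<F>. real (card {xs \<in> ?S. A \<in> prefix_chain xs}))"
    unfolding sum_distrib_left using assms
    by (intro sum.cong) (auto simp: card_permutations_through_set)
  also have "\<dots> = real (\<Sum>xs\<in>?S. card {A \<in> \<F>. A \<in> prefix_chain xs})"
    using fin by (subst sum_multicount_gen) auto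
  also have "\<dots> \<le> real (\<Sum>xs\<in>?S. t + card {AB \<in> far_pairs t \<F>. ?on xs AB})"
    using fin by (intro of_nat_mono sum_mono card_prefix_chain_le_card_far_pairs)
  also have "(\<Sum>xs\<in>?S. t + card {AB \<in> far_pairs t \<F>. ?on xs AB}) =
      fact n * t + (\<Sum>AB\<in>far_pairs t \<F>. card {xs \<in> ?S. ?on xs AB})"
    using assms(1) finite_far_pairs[OF fin] sum_multicount_gen[of ?S "far_pairs t \<F>" ?on]
    by (simp add: sum.distrib n_def)
  also have "real \<dots> = fact n * t + (\<Sum>AB\<in>far_pairs t \<F>. real (card {xs \<in> ?S. ?on xs AB}))"
    by simp
  also have "(\<Sum>AB\<in>far_pairs t \<F>. real (card {xs \<in> ?S. ?on xs AB})) = fact n * ?pairs"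
    unfolding sum_distrib_left using assms
    by (intro sum.cong) (auto simp: far_pairs_def card_permutations_through_two_sets)
  finally have "fact n * ?singles \<le> fact n * (real t + ?pairs)" by (simp add: distrib_left)
  then show ?thesis by simp
qed

section \<open>Supersaturation\<close>

abbreviation middle_binomial :: "nat \<Rightarrow> real" where
  "middle_binomial n \<equiv> real (n choose (n div 2))"

lemma card_div_middle_binomial_le:
  assumes "finite U" "\<F> \<subseteq> Pow U"
  shows "real (card \<F>) / middle_binomial (card U) \<le> (\<Sum>A\<in>\<F>. 1 / real (card U choose card A))"
proof -
  have "1 / middle_binomial (card U) \<le> 1 / real (card U choose card A)" if "A \<in> \<F>" for A
  proof -
    have "card A \<le> card U" using that assms by (meson PowD card_mono subsetD)
    then show ?thesis by (auto simp: binomial_maximum intro!: divide_left_mono)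
  qed
  then have "(\<Sum>A\<in>\<F>. 1 / middle_binomial (card U)) \<le> (\<Sum>A\<in>\<F>. 1 / real (card U choose card A))"
    by (rule sum_mono)
  then show ?thesis by simp
qed

lemma sum_inverse_binomial_le_of_up_degree_le:
  fixes q c :: real
  assumes "finite U" "\<F> \<subseteq> Pow U" "1 \<le> t" "0 < q"
    and far: "\<And>A B. A \<in> \<F> \<Longrightarrow> B \<in> \<F> \<Longrightarrow> card A + t \<le> card B \<Longrightarrow>
      q \<le> real ((card U - card A) choose (card B - card A))"
    and deg: "\<And>A. A \<in> \<F> \<Longrightarrow> real (up_degree \<F> A) \<le> c * q"
  shows "(1 - c) * (\<Sum>A\<in>\<F>. 1 / real (card U choose card A)) \<le> real t"
proof -
  define n where "n = card U"
  define w where "w A = 1 / real (n choose card A)" for A :: "'a set"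
  have fin: "finite \<F>" using assms finite_subset by blast
  have w_nonneg: "0 \<le> w A" for A by (simp add: w_def)
  have "(\<Sum>A\<in>\<F>. w A) \<le>
      real t + (\<Sum>(A, B)\<in>far_pairs t \<F>. w A / real ((n - card A) choose (card B - card A)))"
    using sum_inverse_binomial_le_far_pairs[OF assms(1,2), of t] by (simp add: w_def n_def)
  also have "(\<Sum>(A, B)\<in>far_pairs t \<F>. w A / real ((n - card A) choose (card B - card A))) \<le>
      (\<Sum>(A, B)\<in>far_pairs t \<F>. w A / q)"
  proof (rule sum_mono, clarify)
    fix A B assume "(A, B) \<in> far_pairs t \<F>"
    then have "q \<le> real ((n - card A) choose (card B - card A))"
      unfolding n_def by (intro far) (auto simp: far_pairs_def)
    then show "w A / real ((n - card A) choose (card B - card A)) \<le> w A / q"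
      using assms(4) w_nonneg by (intro frac_le) auto
  qed
  also have "\<dots> \<le> (\<Sum>(A, B)\<in>(SIGMA A:\<F>. {B \<in> \<F>. A \<subset> B}). w A / q)"
    using fin assms(3,4) w_nonneg by (intro sum_mono2) (auto simp: far_pairs_def)
  also have "\<dots> = (\<Sum>A\<in>\<F>. real (up_degree \<F> A) * (w A / q))"
    using fin by (subst sum.Sigma[symmetric]) (auto simp: up_degree_def)
  also have "\<dots> \<le> (\<Sum>A\<in>\<F>. c * q * (w A / q))"
    using deg assms(4) w_nonneg by (intro sum_mono mult_right_mono) auto
  also have "\<dots> = c * (\<Sum>A\<in>\<F>. w A)"
    using assms(4) by (simp add: sum_distrib_left)
  finally show ?thesis by (simp add: w_def n_def algebra_simps)
qed

lemma card_le_of_up_degree_le: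
  fixes q c :: real
  assumes "finite U" "\<F> \<subseteq> Pow U" "1 \<le> t" "0 < q" "c \<le> 1"
    and far: "\<And>A B. A \<in> \<F> \<Longrightarrow> B \<in> \<F> \<Longrightarrow> card A + t \<le> card B \<Longrightarrow>
      q \<le> real ((card U - card A) choose (card B - card A))"
    and deg: "\<And>A. A \<in> \<F> \<Longrightarrow> real (up_degree \<F> A) \<le> c * q"
  shows "(1 - c) * real (card \<F>) \<le> real t * middle_binomial (card U)"
proof -
  have "(1 - c) * (real (card \<F>) / middle_binomial (card U)) \<le>
      (1 - c) * (\<Sum>A\<in>\<F>. 1 / real (card U choose card A))"
    using card_div_middle_binomial_le[OF assms(1,2)] assms(5) by (intro mult_left_mono) auto
  also have "\<dots> \<le> real t"
    using assms(1-4) far deg by (rule sum_inverse_binomial_le_of_up_degree_le)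
  finally show ?thesis by (simp add: field_simps)
qed

lemma binomial_ge_power:
  assumes "t \<le> k" "k + t \<le> N"
  shows "(real N / real t) ^ t \<le> real (N choose k)"
proof -
  have "N choose t \<le> N choose k"
  proof (cases "2 * k \<le> N")
    case True
    then show ?thesis using assms by (intro binomial_mono) auto
  next
    case False
    then have "N choose (N - t) \<le> N choose k" using assms by (intro binomial_antimono) auto
    then show ?thesis using assms by (simp add: binomial_symmetric[of t N])
  qed
  moreover have "(real N / real t) ^ t \<le> real (N choose t)"
    using assms by (intro binomial_ge_n_over_k_pow_k) auto
  ultimately show ?thesis by linarith
qed

lemma card_le_of_up_degree_le_power:
  fixes c :: real
  assumes "finite U" "\<F> \<subseteq> Pow U" "1 \<le> t" "4 * t \<le> card U" "c \<le> 1"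
    and low: "\<And>A. A \<in> \<F> \<Longrightarrow> 4 * card A \<le> 3 * card U"
    and deg: "\<And>A. A \<in> \<F> \<Longrightarrow> real (up_degree \<F> A) \<le> c * (real (card U) / (4 * real t)) ^ t"
  shows "(1 - c) * real (card \<F>) \<le> real t * middle_binomial (card U)"
proof (rule card_le_of_up_degree_le)
  let ?n = "card U"
  fix A B assume A: "A \<in> \<F>" and B: "B \<in> \<F>" and far: "card A + t \<le> card B"
  have "real ?n / 4 \<le> real (?n - card A)" using low[OF A] by linarith
  then have "(real ?n / (4 * real t)) ^ t \<le> (real (?n - card A) / real t) ^ t"
    using assms(3) by (intro power_mono) (auto simp: field_simps)
  also have "\<dots> \<le> real ((?n - card A) choose (card B - card A))"
    using low[OF B] far assms(4) by (intro binomial_ge_power) auto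
  finally show "(real ?n / (4 * real t)) ^ t \<le> real ((?n - card A) choose (card B - card A))" .
qed (use assms in auto)

lemma card_large_subsets_le:
  fixes r :: real
  assumes "finite U" "1 \<le> r"
  shows "real (card {A \<in> Pow U. a * card U \<le> b * card A}) * r ^ (a * card U) \<le>
    (1 + r ^ b) ^ card U"
proof -
  let ?T = "{A \<in> Pow U. a * card U \<le> b * card A}"
  have "real (card ?T) * r ^ (a * card U) \<le> (\<Sum>A\<in>?T. r ^ (b * card A))"
    using sum_mono[of ?T "\<lambda>_. r ^ (a * card U)" "\<lambda>A. r ^ (b * card A)"] assms(2)
    by (simp add: power_increasing)
  also have "\<dots> \<le> (\<Sum>A\<in>Pow U. (r ^ b) ^ card A)"
    unfolding power_mult[symmetric] using assms by (intro sum_mono2) auto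
  also have "\<dots> = (1 + r ^ b) ^ card U"
    using prod_add[OF assms(1), of "\<lambda>_. r ^ b" "\<lambda>_. 1"] by (simp add: add.commute)
  finally show ?thesis .
qed

lemma two_power_le_middle_binomial: "2 ^ n \<le> (real n + 1) * middle_binomial n"
proof -
  have "(2::real) ^ n = real (\<Sum>k\<le>n. n choose k)" by (simp add: choose_row_sum)
  also have "\<dots> \<le> real (\<Sum>k\<le>n. n choose (n div 2))"
    by (intro of_nat_mono sum_mono binomial_maximum)
  finally show ?thesis by (simp add: algebra_simps)
qed

lemma eventually_card_upper_sets_le:
  assumes "0 < \<delta>"
  shows "\<forall>\<^sub>F n in sequentially.
    real (card {A \<in> Pow {1..n}. 3 * n \<le> 4 * card A}) \<le> \<delta> * middle_binomial n"
proof -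
  have "\<forall>\<^sub>F n in sequentially. (real n + 1) * (97 / 108) ^ n < \<delta>"
    by (rule order_tendstoD(2)[of _ 0]) (real_asymp, fact)
  then show ?thesis
  proof eventually_elim
    case (elim n)
    let ?T = "{A \<in> Pow {1..n}. 3 * n \<le> 4 * card A}"
    \<comment> \<open>The ratio \<open>(1 + r ^ 4) / r ^ 3\<close> has to be below 2; \<open>r = 3/2\<close> gives \<open>97/54\<close>.\<close>
    have "real (card ?T) * (27/8) ^ n \<le> (97/16) ^ n"
      using card_large_subsets_le[of "{1..n}" "3/2" 3 4] by (simp add: power_mult power_divide)
    also have "\<dots> = (97/54) ^ n * (27/8) ^ n" by (simp add: power_mult_distrib[symmetric])
    finally have "real (card ?T) \<le> (97/54) ^ n" by simp
    also have "\<dots> = (97/108) ^ n * 2 ^ n" by (simp add: power_mult_distrib[symmetric])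
    also have "\<dots> \<le> (97/108) ^ n * ((real n + 1) * middle_binomial n)"
      by (intro mult_left_mono two_power_le_middle_binomial) simp
    also have "\<dots> = (real n + 1) * (97/108) ^ n * middle_binomial n" by simp
    also have "\<dots> \<le> \<delta> * middle_binomial n" using elim by (intro mult_right_mono) auto
    finally show ?case .
  qed
qed

lemma supersaturated_Pow:
  fixes \<delta> :: real
  assumes "finite U" "1 \<le> t" "4 * t \<le> card U" "0 < \<delta>"
    and tail: "real (card {A \<in> Pow U. 3 * card U \<le> 4 * card A}) \<le> \<delta> * middle_binomial (card U)"
  shows "supersaturated ((real t + 2 * \<delta>) * middle_binomial (card U))
    (\<delta> / (real t + \<delta>) * (real (card U) / (4 * real t)) ^ t) (Pow U)"
proof -
  let ?m = "middle_binomial (card U)"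
    and ?d = "\<delta> / (real t + \<delta>) * (real (card U) / (4 * real t)) ^ t"
  have "real (card \<F>) \<le> (real t + 2 * \<delta>) * ?m"
    if \<F>: "\<F> \<subseteq> Pow U" and deg: "\<And>A. A \<in> \<F> \<Longrightarrow> real (up_degree \<F> A) < ?d" for \<F>
  proof -
    define \<G> where "\<G> = {A \<in> \<F>. 4 * card A \<le> 3 * card U}"
    have fin: "finite \<F>" using \<F> assms(1) finite_subset by blast
    have "real (up_degree \<G> A) \<le> ?d" if "A \<in> \<G>" for A
      using up_degree_mono[OF fin, of \<G> A] deg[of A] that by (auto simp: \<G>_def)
    then have "(1 - \<delta> / (real t + \<delta>)) * real (card \<G>) \<le> real t * ?m"
      using \<F> assms by (intro card_le_of_up_degree_le_power[of U]) (auto simp: \<G>_def)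
    also have "1 - \<delta> / (real t + \<delta>) = real t / (real t + \<delta>)"
      using assms(4) by (simp add: field_simps)
    finally have "real t * real (card \<G>) \<le> real t * ((real t + \<delta>) * ?m)"
      using assms(4) by (simp add: field_simps)
    then have "real (card \<G>) \<le> (real t + \<delta>) * ?m" using assms(2) by simp
    moreover have "card \<F> \<le> card (\<G> \<union> {A \<in> Pow U. 3 * card U \<le> 4 * card A})"
      using \<F> fin assms(1) by (intro card_mono) (auto simp: \<G>_def)
    then have "card \<F> \<le> card \<G> + card {A \<in> Pow U. 3 * card U \<le> 4 * card A}"
      using card_Un_le order_trans by blast
    ultimately show ?thesis using tail by (simp add: algebra_simps)
  qed
  then show ?thesis unfolding supersaturated_def by (meson not_le)
qed

lemma eventually_supersaturated_Pow:
  fixes \<delta> :: real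
  assumes "0 < \<delta>" "1 \<le> t"
  obtains c where "0 < c" "\<forall>\<^sub>F n in sequentially.
    supersaturated ((real t + \<delta>) * middle_binomial n) (c * real n ^ t) (Pow {1..n})"
proof
  let ?c = "\<delta> / 2 / (real t + \<delta> / 2) / (4 * real t) ^ t"
  show "0 < ?c" using assms by simp
  have "\<forall>\<^sub>F n in sequentially.
      real (card {A \<in> Pow {1..n}. 3 * n \<le> 4 * card A}) \<le> \<delta> / 2 * middle_binomial n"
    using assms(1) by (intro eventually_card_upper_sets_le) simp
  then show "\<forall>\<^sub>F n in sequentially.
      supersaturated ((real t + \<delta>) * middle_binomial n) (?c * real n ^ t) (Pow {1..n})"
    using eventually_ge_at_top[of "4 * t"]
  proof eventually_elim
    case (elim n)
    then show ?case
      using supersaturated_Pow[of "{1..n}" t "\<delta> / 2"] assms by (simp add: power_divide)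
  qed
qed

section \<open>The largest antichain in a random family\<close>

lemma eventually_antichain_moment_bounded_middle:
  fixes \<delta> \<beta> s K :: real
  assumes "0 < \<delta>" "0 < \<beta>" "0 \<le> s" "0 < K" "1 \<le> t"
  obtains C where "\<forall>\<^sub>F n in sequentially. \<forall>p\<in>{0..1}. C \<le> p * real n ^ t \<longrightarrow>
    antichain_moment_bounded p s (Pow {1..n}) (K * middle_binomial n)
      (exp (((exp s - 1) * (real t + \<delta>) + \<beta>) * (p * middle_binomial n)))"
proof -
  obtain c where "0 < c" and supersat: "\<forall>\<^sub>F n in sequentially.
      supersaturated ((real t + \<delta>) * middle_binomial n) (c * real n ^ t) (Pow {1..n})"
    using eventually_supersaturated_Pow[OF assms(1,5)] .
  define y where "y = \<beta> / K"
  have "0 < y" using assms by (simp add: y_def)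
  show ?thesis
  proof (rule that[of "(s - ln y) / (y * c)"], use supersat in eventually_elim, intro ballI impI)
    fix n p
    let ?m = "middle_binomial n" and ?N = "(real t + \<delta>) * middle_binomial n"
    assume supersat: "supersaturated ?N (c * real n ^ t) (Pow {1..n})"
      and p: "p \<in> {0..1}" and large: "(s - ln y) / (y * c) \<le> p * real n ^ t"
    have "s - y * (p * (c * real n ^ t)) \<le> ln y"
      using large \<open>0 < y\<close> \<open>0 < c\<close> by (simp add: field_simps)
    then have "exp (s - y * (p * (c * real n ^ t))) \<le> y"
      using \<open>0 < y\<close> by (simp add: ln_ge_iff)
    moreover have "antichain_moment_bounded p s (Pow {1..n}) ?N (exp (p * (exp s - 1) * ?N))"
      using p assms(3) by (intro antichain_moment_bounded_exp) auto
    ultimately have "antichain_moment_bounded p s (Pow {1..n}) (K * ?m)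
        (exp (p * (exp s - 1) * ?N) * exp (p * y * (K * ?m)))"
      using p assms(3) supersat by (intro antichain_moment_bounded_descent) auto
    also have "exp (p * (exp s - 1) * ?N) * exp (p * y * (K * ?m)) =
        exp (((exp s - 1) * (real t + \<delta>) + \<beta>) * (p * ?m))"
      unfolding exp_add[symmetric] using assms(4) by (simp add: y_def algebra_simps)
    finally show "antichain_moment_bounded p s (Pow {1..n}) (K * ?m)
        (exp (((exp s - 1) * (real t + \<delta>) + \<beta>) * (p * ?m)))" .
  qed
qed

lemma eventually_exp_le_middle_binomial_ratio:
  fixes \<beta> c s :: real
  assumes "0 < \<beta>" "0 < c"
  shows "\<forall>\<^sub>F n in sequentially. \<forall>p. 1 \<le> p * real n ^ t \<longrightarrow>
    exp (s - \<beta> * middle_binomial n / 2 ^ n * (p * (c * real n ^ (t + 2)))) \<le>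
    \<beta> * middle_binomial n / 2 ^ n"
proof -
  have "\<forall>\<^sub>F n in sequentially.
      exp (s - \<beta> / (real n + 1) * (c * real n ^ 2)) \<le> \<beta> / (real n + 1)"
    using assms by real_asymp
  then show ?thesis
  proof (eventually_elim, intro allI impI)
    fix n p
    let ?y = "\<beta> * middle_binomial n / 2 ^ n"
    assume decay: "exp (s - \<beta> / (real n + 1) * (c * real n ^ 2)) \<le> \<beta> / (real n + 1)"
      and large: "1 \<le> p * real n ^ t"
    have y_ge: "\<beta> / (real n + 1) \<le> ?y"
      using mult_left_mono[OF two_power_le_middle_binomial[of n], of \<beta>] assms(1)
      by (simp add: field_simps)
    have "c * real n ^ 2 \<le> p * (c * real n ^ (t + 2))"
      using mult_left_mono[OF large, of "c * real n ^ 2"] assms(2)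
      by (simp add: power_add power2_eq_square mult_ac)
    with y_ge have "\<beta> / (real n + 1) * (c * real n ^ 2) \<le> ?y * (p * (c * real n ^ (t + 2)))"
      by (rule mult_mono) (use assms in auto)
    then have "exp (s - ?y * (p * (c * real n ^ (t + 2)))) \<le>
        exp (s - \<beta> / (real n + 1) * (c * real n ^ 2))" by simp
    with decay y_ge show "exp (s - ?y * (p * (c * real n ^ (t + 2)))) \<le> ?y" by linarith
  qed
qed

lemma eventually_antichain_moment_Pow_le_exp:
  fixes \<delta> \<beta> s :: real
  assumes "0 < \<delta>" "0 < \<beta>" "0 \<le> s" "1 \<le> t"
  obtains C where "0 < C" "\<forall>\<^sub>F n in sequentially. \<forall>p\<in>{0..1}. C \<le> p * real n ^ t \<longrightarrow>
    antichain_moment p s (Pow {1..n}) \<le>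
      exp (((exp s - 1) * (real t + \<delta>) + \<beta>) * (p * middle_binomial n))"
proof -
  let ?a = "(exp s - 1) * (real t + \<delta>)" and ?K = "real (t + 2) + \<delta>"
  have half: "0 < \<beta> / 2" and "0 < ?K" using assms by auto
  then obtain C where middle:
    "\<forall>\<^sub>F n in sequentially. \<forall>p\<in>{0..1}. C \<le> p * real n ^ t \<longrightarrow>
      antichain_moment_bounded p s (Pow {1..n}) (?K * middle_binomial n)
        (exp ((?a + \<beta> / 2) * (p * middle_binomial n)))"
    using eventually_antichain_moment_bounded_middle[OF assms(1) _ assms(3) _ assms(4)] by blast
  obtain c where "0 < c" and supersat: "\<forall>\<^sub>F n in sequentially.
      supersaturated (?K * middle_binomial n) (c * real n ^ (t + 2)) (Pow {1..n})"
    using eventually_supersaturated_Pow[OF assms(1), of "t + 2"] by auto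
  show ?thesis
  proof (rule that[of "max 1 C"], simp, use middle supersat
      eventually_exp_le_middle_binomial_ratio[OF half \<open>0 < c\<close>, of t s] in eventually_elim,
      intro ballI impI)
    fix n p
    let ?m = "middle_binomial n" and ?y = "\<beta> / 2 * middle_binomial n / 2 ^ n"
    assume p: "p \<in> {0..1}" and large: "max 1 C \<le> p * real n ^ t"
      and middle: "\<forall>p\<in>{0..1}. C \<le> p * real n ^ t \<longrightarrow> antichain_moment_bounded p s (Pow {1..n})
        (?K * ?m) (exp ((?a + \<beta> / 2) * (p * ?m)))"
      and supersat: "supersaturated (?K * ?m) (c * real n ^ (t + 2)) (Pow {1..n})"
      and admissible: "\<forall>p. 1 \<le> p * real n ^ t \<longrightarrow>
        exp (s - ?y * (p * (c * real n ^ (t + 2)))) \<le> ?y"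
    have "antichain_moment_bounded p s (Pow {1..n}) (2 ^ n)
        (exp ((?a + \<beta> / 2) * (p * ?m)) * exp (p * ?y * 2 ^ n))"
      by (rule antichain_moment_bounded_descent)
        (use p large assms(3) middle supersat admissible in auto)
    then have "antichain_moment p s (Pow {1..n}) \<le>
        exp ((?a + \<beta> / 2) * (p * ?m)) * exp (p * ?y * 2 ^ n)"
      by (simp add: antichain_moment_bounded_def card_Pow)
    also have "\<dots> = exp ((?a + \<beta>) * (p * ?m))"
      unfolding exp_add[symmetric] by (simp add: field_simps)
    finally show "antichain_moment p s (Pow {1..n}) \<le> exp ((?a + \<beta>) * (p * ?m))" .
  qed
qed

lemma chernoff_exponent_le:
  fixes \<epsilon> \<delta> t :: real
  assumes "0 \<le> \<delta>" "\<delta> \<le> 1" "4 * \<delta> \<le> \<epsilon>" "1 \<le> t"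
  shows "(exp \<delta> - 1) * (t + \<delta>) - \<delta> * ((1 + \<epsilon>) * t) \<le> - (\<delta> ^ 2)"
proof -
  have "(exp \<delta> - 1) * (t + \<delta>) \<le> (\<delta> + \<delta> ^ 2) * (t + \<delta>)"
    using exp_bound[of \<delta>] assms by (intro mult_right_mono) auto
  moreover have "\<delta> * ((1 + 4 * \<delta>) * t) \<le> \<delta> * ((1 + \<epsilon>) * t)"
    using assms by (intro mult_left_mono mult_right_mono) auto
  moreover have "\<delta> ^ 2 * 1 \<le> \<delta> ^ 2 * t" "\<delta> ^ 2 * \<delta> \<le> \<delta> ^ 2 * 1"
    using assms(2,4) by (simp_all only: mult_left_mono zero_le_power2)
  ultimately show ?thesis by (simp add: algebra_simps power2_eq_square)
qed

lemma eventually_prob_largest_antichain_size_le: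
  fixes \<epsilon> :: real
  assumes "0 < \<epsilon>" "1 \<le> t"
  obtains C \<beta> where "0 < C" "0 < \<beta>"
    "\<forall>\<^sub>F n in sequentially. \<forall>p\<in>{0..1}. C \<le> p * real n ^ t \<longrightarrow>
      1 - exp (- (\<beta> * (p * middle_binomial n))) \<le> measure_pmf.prob (random_family n p)
        {\<F>. real (largest_antichain_size \<F>) \<le> (1 + \<epsilon>) * p * middle_binomial n * real t}"
proof -
  define \<delta> \<beta> where "\<delta> = min 1 (\<epsilon> / 4)" and "\<beta> = \<delta> ^ 2 / 2"
  have \<delta>: "0 < \<delta>" "0 \<le> \<delta>" "\<delta> \<le> 1" "4 * \<delta> \<le> \<epsilon>" and "0 < \<beta>"
    using assms(1) by (auto simp: \<delta>_def \<beta>_def)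
  obtain C where "0 < C" and moment:
    "\<forall>\<^sub>F n in sequentially. \<forall>p\<in>{0..1}. C \<le> p * real n ^ t \<longrightarrow>
      antichain_moment p \<delta> (Pow {1..n}) \<le>
        exp (((exp \<delta> - 1) * (real t + \<delta>) + \<beta>) * (p * middle_binomial n))"
    using eventually_antichain_moment_Pow_le_exp[OF \<delta>(1) \<open>0 < \<beta>\<close> \<delta>(2) assms(2)] .
  show ?thesis
  proof (rule that[OF \<open>0 < C\<close> \<open>0 < \<beta>\<close>], use moment in eventually_elim, intro ballI impI)
    fix n p
    let ?X = "p * middle_binomial n" and ?k = "(1 + \<epsilon>) * p * middle_binomial n * real t"
      and ?a = "(exp \<delta> - 1) * (real t + \<delta>)"
    assume "\<forall>p\<in>{0..1}. C \<le> p * real n ^ t \<longrightarrow>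
        antichain_moment p \<delta> (Pow {1..n}) \<le> exp ((?a + \<beta>) * (p * middle_binomial n))"
      and p: "p \<in> {0..1}" and "C \<le> p * real n ^ t"
    then have "exp (- \<delta> * ?k) * antichain_moment p \<delta> (Pow {1..n}) \<le>
        exp (- \<delta> * ?k) * exp ((?a + \<beta>) * ?X)"
      by (intro mult_left_mono) auto
    also have "\<dots> = exp ((?a - \<delta> * ((1 + \<epsilon>) * real t) + \<beta>) * ?X)"
      unfolding exp_add[symmetric] by (simp add: algebra_simps)
    also have "\<dots> \<le> exp (- \<beta> * ?X)"
      using chernoff_exponent_le[OF \<delta>(2-4), of "real t"] assms(2) p
      unfolding exp_le_cancel_iff by (intro mult_right_mono) (auto simp: \<beta>_def)
    finally show "1 - exp (- (\<beta> * ?X)) \<le> measure_pmf.prob (random_family n p)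
        {\<F>. real (largest_antichain_size \<F>) \<le> ?k}"
      using prob_largest_antichain_size_le[of "Pow {1..n}" \<delta> ?k p] \<delta>(1)
      by (simp add: random_family_eq_random_subset)
  qed
qed

lemma filterlim_mult_middle_binomial_at_top:
  fixes C :: real
  assumes "0 < C" "\<forall>\<^sub>F n in sequentially. C / real n ^ t < p n"
  shows "filterlim (\<lambda>n. p n * middle_binomial n) at_top sequentially"
proof (rule filterlim_at_top_mono)
  show "filterlim (\<lambda>n. C / real n ^ t * (2 ^ n / (real n + 1))) at_top sequentially"
    using assms(1) by real_asymp
  show "\<forall>\<^sub>F n in sequentially. C / real n ^ t * (2 ^ n / (real n + 1)) \<le> p n * middle_binomial n"
    using assms(2)
  proof eventually_elim
    case (elim n)
    have "2 ^ n / (real n + 1) \<le> middle_binomial n"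
      using two_power_le_middle_binomial[of n] by (simp add: field_simps)
    moreover have "0 \<le> C / real n ^ t" using assms(1) by simp
    ultimately show ?case using elim by (intro mult_mono) auto
  qed
qed

theorem theorem2:
  fixes \<epsilon> :: real and t :: nat
  assumes "\<epsilon> > 0" and "t \<ge> 1"
  shows "\<exists>C::real. \<forall>p :: nat \<Rightarrow> real.
    (\<forall>n\<ge>1. 0 \<le> p n \<and> p n \<le> 1) \<longrightarrow>
    (\<forall>\<^sub>F n in sequentially. p n > C / real n ^ t) \<longrightarrow>
    (\<lambda>n. measure_pmf.prob (random_family n (p n))
       {\<F>. real (largest_antichain_size \<F>)
            \<le> (1 + \<epsilon>) * p n * real (n choose (n div 2)) * real t})
      \<longlonglongrightarrow> 1"
proof -
  obtain C \<beta> where "0 < C" "0 < \<beta>" and lower: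
    "\<forall>\<^sub>F n in sequentially. \<forall>p\<in>{0..1}. C \<le> p * real n ^ t \<longrightarrow>
      1 - exp (- (\<beta> * (p * middle_binomial n))) \<le> measure_pmf.prob (random_family n p)
        {\<F>. real (largest_antichain_size \<F>) \<le> (1 + \<epsilon>) * p * middle_binomial n * real t}"
    using eventually_prob_largest_antichain_size_le[OF assms] .
  show ?thesis
  proof (intro exI[of _ C] allI impI, rule tendsto_sandwich[where h = "\<lambda>_. 1"])
    fix p :: "nat \<Rightarrow> real"
    assume p: "\<forall>n\<ge>1. 0 \<le> p n \<and> p n \<le> 1"
      and dense: "\<forall>\<^sub>F n in sequentially. p n > C / real n ^ t"
    have "((\<lambda>x. 1 - exp (- (\<beta> * x))) \<longlongrightarrow> 1) at_top" using \<open>0 < \<beta>\<close> by real_asymp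
    then show "(\<lambda>n. 1 - exp (- (\<beta> * (p n * middle_binomial n)))) \<longlonglongrightarrow> 1"
      using filterlim_mult_middle_binomial_at_top[OF \<open>0 < C\<close> dense] by (rule filterlim_compose)
    show "\<forall>\<^sub>F n in sequentially. 1 - exp (- (\<beta> * (p n * middle_binomial n))) \<le>
        measure_pmf.prob (random_family n (p n))
          {\<F>. real (largest_antichain_size \<F>) \<le> (1 + \<epsilon>) * p n * middle_binomial n * real t}"
      using lower dense eventually_gt_at_top[of 0]
      by eventually_elim (use p in \<open>force simp: field_simps\<close>)
  qed simp_all
qed

end
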